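(* There are exactly two types of quadratic bicomplex extensions of $\mathbb{Q}$: every unital $\mathbb{Q}$-subalgebra $L\subset\mathbb{B}$ with $\dim_{\mathbb{Q}}L=2$ is, up to isomorphism of $\mathbb{Q}$-algebras, either a classical quadratic field $\mathbb{Q}(\sqrt d)$ with $d\neq 1$ a squarefree integer, or the hyperbolic extension $\mathbb{Q}[\mathbf j]=\mathbb{Q}\mathbf e_1+\mathbb{Q}\mathbf e_2$.
   Context: The bicomplex numbers are the commutative 4-dimensional real algebra $\mathbb{B}=\{x+y\mathbf i+z\mathbf j+t\mathbf k: x,y,z,t\in\mathbb{R}\}$ with $\mathbf i^2=\mathbf k^2=-1$, $\mathbf j^2=1$, $\mathbf i\mathbf j=\mathbf j\mathbf i=\mathbf k$. Put $\mathbf e_1=\frac{1+\mathbf j}{2}$, $\mathbf e_2=\frac{1-\mathbf j}{2}$. $\mathbb{Q}[\mathbf j]$ is the $\mathbb{Q}$-subalgebra of $\mathbb{B}$ generated by $\mathbf j$. *)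

theory Defs
  imports Complex_Main "HOL-Computational_Algebra.Squarefree"
begin

definition rat_scale :: "rat \<Rightarrow> 'a::real_vector \<Rightarrow> 'a" (infixr "*\<^sub>Q" 75)
  where "q *\<^sub>Q x = (of_rat q :: real) *\<^sub>R x"

global_interpretation rat: vector_space "rat_scale :: rat \<Rightarrow> 'a::real_vector \<Rightarrow> 'a"
  defines rat_subspace = rat.subspace
    and rat_dependent = rat.dependent
    and rat_span = rat.span
    and rat_extend_basis = rat.extend_basis
    and rat_dim = rat.dim
  by unfold_locales (simp_all add: rat_scale_def algebra_simps of_rat_add of_rat_mult)

definition rat_subalgebra :: "'a::real_algebra_1 set \<Rightarrow> bool"
  where "rat_subalgebra A \<longleftrightarrow>
    rat_subspace A \<and> 1 \<in> A \<and> (\<forall>x\<in>A. \<forall>y\<in>A. x * y \<in> A)"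

definition rat_algebra_isomorphic :: "'a::real_algebra_1 set \<Rightarrow> 'b::real_algebra_1 set \<Rightarrow> bool"
  where "rat_algebra_isomorphic A B \<longleftrightarrow>
    (\<exists>f. bij_betw f A B \<and> f 1 = 1 \<and>
      (\<forall>x\<in>A. \<forall>y\<in>A. f (x + y) = f x + f y) \<and>
      (\<forall>x\<in>A. \<forall>y\<in>A. f (x * y) = f x * f y) \<and>
      (\<forall>q. \<forall>x\<in>A. f (q *\<^sub>Q x) = q *\<^sub>Q f x))"

definition is_subfield :: "'a::field set \<Rightarrow> bool"
  where "is_subfield K \<longleftrightarrow>
    0 \<in> K \<and> 1 \<in> K \<and> (\<forall>x\<in>K. \<forall>y\<in>K. x + y \<in> K \<and> x * y \<in> K) \<and>
    (\<forall>x\<in>K. - x \<in> K \<and> inverse x \<in> K)"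

text \<open>Every subfield of the complex numbers contains the rationals, so the subfield generated by
  a square root of \<open>d\<close> is the extension of the rationals generated by it.\<close>

definition quadratic_field :: "int \<Rightarrow> complex set"
  where "quadratic_field d = is_subfield hull {csqrt (of_int d)}"

text \<open>\<open>Bicomplex x y z t\<close> stands for $x + y\mathbf{i} + z\mathbf{j} + t\mathbf{k}$.\<close>

datatype bicomplex = Bicomplex (bc_1: real) (bc_i: real) (bc_j: real) (bc_k: real)

lemma bicomplex_eq_iff:
  "u = v \<longleftrightarrow> bc_1 u = bc_1 v \<and> bc_i u = bc_i v \<and> bc_j u = bc_j v \<and> bc_k u = bc_k v"
  by (cases u; cases v) simp

instantiation bicomplex :: "{comm_ring_1, real_algebra_1}"
begin

definition "0 = Bicomplex 0 0 0 0"

definition "1 = Bicomplex 1 0 0 0"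

definition "u + v = Bicomplex (bc_1 u + bc_1 v) (bc_i u + bc_i v) (bc_j u + bc_j v) (bc_k u + bc_k v)"

definition "- u = Bicomplex (- bc_1 u) (- bc_i u) (- bc_j u) (- bc_k u)"

definition "u - v = Bicomplex (bc_1 u - bc_1 v) (bc_i u - bc_i v) (bc_j u - bc_j v) (bc_k u - bc_k v)"

definition "r *\<^sub>R u = Bicomplex (r * bc_1 u) (r * bc_i u) (r * bc_j u) (r * bc_k u)"

text \<open>The bilinear product determined by \<open>bc_mult_table\<close> below.\<close>

definition "u * v = Bicomplex
    (bc_1 u * bc_1 v - bc_i u * bc_i v + bc_j u * bc_j v - bc_k u * bc_k v)
    (bc_1 u * bc_i v + bc_i u * bc_1 v + bc_j u * bc_k v + bc_k u * bc_j v)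
    (bc_1 u * bc_j v + bc_j u * bc_1 v - bc_i u * bc_k v - bc_k u * bc_i v)
    (bc_1 u * bc_k v + bc_k u * bc_1 v + bc_i u * bc_j v + bc_j u * bc_i v)"

instance
  by standard
    (simp_all add: bicomplex_eq_iff zero_bicomplex_def one_bicomplex_def plus_bicomplex_def
      uminus_bicomplex_def minus_bicomplex_def scaleR_bicomplex_def times_bicomplex_def
      algebra_simps)

end

definition bci :: bicomplex where "bci = Bicomplex 0 1 0 0"

definition bcj :: bicomplex where "bcj = Bicomplex 0 0 1 0"

definition bck :: bicomplex where "bck = Bicomplex 0 0 0 1"

lemma bc_mult_table:
  "bci * bci = -1" "bcj * bcj = 1" "bck * bck = -1" "bci * bcj = bck" "bcj * bci = bck"
  by (simp_all add: bci_def bcj_def bck_def times_bicomplex_def one_bicomplex_def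
      uminus_bicomplex_def)

lemma Bicomplex_eq:
  "Bicomplex x y z t = x *\<^sub>R 1 + y *\<^sub>R bci + z *\<^sub>R bcj + t *\<^sub>R bck"
  by (simp add: bci_def bcj_def bck_def one_bicomplex_def plus_bicomplex_def scaleR_bicomplex_def)

definition bce1 :: bicomplex where "bce1 = (1/2) *\<^sub>R (1 + bcj)"

definition bce2 :: bicomplex where "bce2 = (1/2) *\<^sub>R (1 - bcj)"

definition hyperbolic_extension :: "bicomplex set"
  where "hyperbolic_extension = rat_subalgebra hull {bcj}"

text \<open>\<open>rat_dim\<close> is 0 on infinite-dimensional subspaces, so dimension 2 includes finiteness.\<close>

definition quadratic_bicomplex_extension :: "bicomplex set \<Rightarrow> bool"
  where "quadratic_bicomplex_extension L \<longleftrightarrow> rat_subalgebra L \<and> rat_dim L = 2"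

end

theory Submission
  imports Defs
begin

text \<open>
  A two-dimensional unital \<open>\<rat>\<close>-algebra has a basis \<open>1, w\<close>, and completing the square in the
  relation \<open>w\<^sup>2 = c + b w\<close> gives a generator \<open>u = w - b/2\<close> whose square is rational. The bicomplex
  numbers form a ring isomorphic to \<open>\<complex> \<times> \<complex>\<close>, so they are reduced and \<open>u\<^sup>2 \<noteq> 0\<close>. Multiplying \<open>u\<close>
  by a nonzero rational changes \<open>u\<^sup>2\<close> by a rational square, so \<open>u\<^sup>2\<close> may be assumed to be a
  squarefree integer \<open>d\<close> (lemma \<open>quadratic_algebra_squarefree_generator\<close>).

  The multiplication of \<open>\<rat> + \<rat>u\<close> depends only on \<open>u\<^sup>2\<close>, so \<open>d\<close> determines the algebra up to
  isomorphism (lemma \<open>rat_algebra_isomorphic_span_same_square\<close>). If \<open>d = 1\<close>, it is the algebra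
  of \<open>\<^bold>j\<close>. Otherwise \<open>\<surd>d\<close> is irrational and the model is \<open>\<rat> + \<rat>\<surd>d\<close>, which is already a field
  and hence all of \<open>\<rat>(\<surd>d)\<close>. Conversely \<open>\<complex> = \<real> + \<real>\<^bold>i\<close> lies in the bicomplex numbers, so every \<open>d\<close>
  occurs. The two types are distinct because \<open>\<^bold>e\<^sub>1 \<^bold>e\<^sub>2 = 0\<close>, whereas a field has no zero divisors.
\<close>

section \<open>Algebras generated by an element with rational square\<close>

definition quad_elt :: "'a::real_algebra_1 \<Rightarrow> rat \<times> rat \<Rightarrow> 'a"
  where "quad_elt u p = fst p *\<^sub>Q 1 + snd p *\<^sub>Q u"

lemma rat_scale_complex: "q *\<^sub>Q (z::complex) = of_rat q * z"
proof -
  have "complex_of_real (of_rat q) = of_rat q"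
    by (cases q) (simp add: of_rat_rat)
  then show ?thesis by (simp add: rat_scale_def scaleR_conv_of_real)
qed

lemma rat_scale_one_mult [simp]:
  fixes x :: "'a::real_algebra_1"
  shows "(q *\<^sub>Q 1) * x = q *\<^sub>Q x" "x * (q *\<^sub>Q 1) = q *\<^sub>Q x"
  by (simp_all add: rat_scale_def)

lemma rat_scale_mult:
  fixes x y :: "'a::real_algebra_1"
  shows "(q *\<^sub>Q x) * (r *\<^sub>Q y) = (q * r) *\<^sub>Q (x * y)"
  by (simp add: rat_scale_def of_rat_mult)

lemma range_quad_elt: "range (quad_elt u) = rat_span {1, u}"
proof -
  have "x \<in> rat_span {1, u} \<longleftrightarrow> (\<exists>a b. x = quad_elt u (a, b))" for x
  proof -
    have "x \<in> rat_span {1, u} \<longleftrightarrow> (\<exists>a b. x - a *\<^sub>Q 1 = b *\<^sub>Q u)"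
      by (auto simp: rat.span_breakdown_eq rat.span_singleton)
    also have "\<dots> \<longleftrightarrow> (\<exists>a b. x = quad_elt u (a, b))"
      by (simp add: quad_elt_def algebra_simps)
    finally show ?thesis .
  qed
  then show ?thesis by (auto simp: image_iff)
qed

lemma quad_elt_1: "quad_elt u (1, 0) = 1"
  by (simp add: quad_elt_def)

lemma quad_elt_gen: "quad_elt u (0, 1) = u"
  by (simp add: quad_elt_def)

lemma quad_elt_add: "quad_elt u (a, b) + quad_elt u (a', b') = quad_elt u (a + a', b + b')"
  by (simp add: quad_elt_def rat.scale_left_distrib)

lemma quad_elt_scale: "q *\<^sub>Q quad_elt u (a, b) = quad_elt u (q * a, q * b)"
  by (simp add: quad_elt_def rat.scale_right_distrib)

lemma quad_elt_mult:
  assumes "u * u = c *\<^sub>Q 1"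
  shows "quad_elt u (a, b) * quad_elt u (a', b') = quad_elt u (a * a' + b * b' * c, a * b' + b * a')"
proof -
  have "quad_elt u (a, b) * quad_elt u (a', b')
      = (a * a') *\<^sub>Q 1 + (a * b') *\<^sub>Q u + (b * a') *\<^sub>Q u + (b * b') *\<^sub>Q (u * u)"
    by (simp add: quad_elt_def distrib_left distrib_right rat_scale_mult rat.scale_right_distrib
        mult.commute)
  then show ?thesis
    by (simp add: assms quad_elt_def rat.scale_left_distrib)
qed

lemma quad_elt_eq_0_iff:
  assumes "\<And>q. u \<noteq> q *\<^sub>Q 1"
  shows "quad_elt u (a, b) = 0 \<longleftrightarrow> a = 0 \<and> b = 0"
proof
  assume eq: "quad_elt u (a, b) = 0"
  have b: "b = 0"
  proof (rule ccontr)
    assume "b \<noteq> 0"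
    have "quad_elt u (a / b, 1) = (1 / b) *\<^sub>Q quad_elt u (a, b)"
      using \<open>b \<noteq> 0\<close> by (simp add: quad_elt_scale)
    also have "\<dots> = 0"
      by (simp only: eq rat.scale_zero_right)
    finally have "u = (- (a / b)) *\<^sub>Q 1"
      by (simp add: quad_elt_def add_eq_0_iff)
    with assms show False by blast
  qed
  with eq have "a *\<^sub>Q (1::'a) = 0" by (simp add: quad_elt_def)
  with b show "a = 0 \<and> b = 0" by simp
qed (simp add: quad_elt_def)

lemma inj_quad_elt:
  assumes "\<And>q. u \<noteq> q *\<^sub>Q 1"
  shows "inj (quad_elt u)"
proof (rule injI)
  fix x y :: "rat \<times> rat"
  assume eq: "quad_elt u x = quad_elt u y"
  have "quad_elt u (fst x - fst y, snd x - snd y) = quad_elt u x - quad_elt u y"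
    by (simp add: quad_elt_def rat.scale_left_diff_distrib)
  with eq quad_elt_eq_0_iff[OF assms] show "x = y"
    by (simp add: prod_eq_iff)
qed

text \<open>The coordinates \<open>(a, b)\<close> of \<open>a + b u\<close> are unique because \<open>u\<close> is irrational, and the product
  in these coordinates involves \<open>u\<close> only through \<open>c = u\<^sup>2\<close>; keeping coordinates and replacing
  \<open>u\<close> by \<open>v\<close> is therefore an isomorphism.\<close>

lemma rat_algebra_isomorphic_span_same_square:
  fixes u :: "'a::real_algebra_1" and v :: "'b::real_algebra_1"
  assumes u: "u * u = c *\<^sub>Q 1" "\<And>q. u \<noteq> q *\<^sub>Q 1"
    and v: "v * v = c *\<^sub>Q 1" "\<And>q. v \<noteq> q *\<^sub>Q 1"
  shows "rat_algebra_isomorphic (rat_span {1, u}) (rat_span {1, v})"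
proof -
  define f where "f = quad_elt v \<circ> inv (quad_elt u)"
  have f: "f (quad_elt u p) = quad_elt v p" for p
    by (simp add: f_def inj_quad_elt[OF u(2)])
  have "bij_betw f (range (quad_elt u)) (range (quad_elt v))"
    unfolding f_def
    using inj_quad_elt[OF u(2)] inj_quad_elt[OF v(2)]
    by (intro bij_betw_trans[OF bij_betw_inv_into]) (simp_all add: inj_on_imp_bij_betw)
  moreover have "f 1 = 1"
    using f[of "(1, 0)"] by (simp add: quad_elt_1)
  ultimately show ?thesis
    unfolding rat_algebra_isomorphic_def range_quad_elt[symmetric]
    by (intro exI[of _ f])
      (auto simp: f quad_elt_add quad_elt_scale quad_elt_mult[OF u(1)] quad_elt_mult[OF v(1)])
qed

lemma rat_subalgebra_span:
  assumes "u * u = c *\<^sub>Q 1"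
  shows "rat_subalgebra (rat_span {1, u})"
proof -
  have "x * y \<in> range (quad_elt u)" if "x \<in> range (quad_elt u)" "y \<in> range (quad_elt u)" for x y
    using that by (auto simp: quad_elt_mult[OF assms])
  then show ?thesis
    by (simp add: rat_subalgebra_def range_quad_elt rat.span_base)
qed

lemma rat_subalgebra_hull_eq_span:
  assumes "u * u = c *\<^sub>Q 1"
  shows "rat_subalgebra hull {u} = rat_span {1, u}"
proof (rule hull_unique)
  show "{u} \<subseteq> rat_span {1, u}" by (simp add: rat.span_base)
  show "rat_subalgebra (rat_span {1, u})" by (rule rat_subalgebra_span[OF assms])
  show "rat_span {1, u} \<subseteq> A" if "{u} \<subseteq> A" "rat_subalgebra A" for A
    using that by (intro rat.span_minimal) (auto simp: rat_subalgebra_def)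
qed

lemma rat_dim_span_quadratic:
  fixes u :: "'a::real_algebra_1"
  assumes "\<And>q. u \<noteq> q *\<^sub>Q 1"
  shows "rat_dim (rat_span {1, u}) = 2"
proof -
  have "u \<noteq> 1" using assms[of 1] by simp
  moreover have "\<not> rat_dependent {u, 1}"
    using assms by (intro rat.independent_insertI) (auto simp: rat.span_singleton rat.independent_empty rat.dependent_single)
  ultimately show ?thesis
    by (simp add: rat.dim_span rat.dim_eq_card_independent insert_commute)
qed

section \<open>Squarefree generators\<close>

text \<open>In lowest terms \<open>d = (a/b)\<^sup>2\<close> forces \<open>b = 1\<close>, and then squarefreeness forces \<open>a = \<plusminus>1\<close>.\<close>

lemma squarefree_not_rat_square:
  assumes d: "squarefree d" "d \<noteq> 1" and sq: "q\<^sup>2 = rat_of_int d"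
  shows False
proof -
  obtain a b where q: "q = Fract a b" "b > 0" "coprime a b" by (cases q) auto
  have "rat_of_int (a\<^sup>2) = rat_of_int (d * b\<^sup>2)"
    using sq q(2) unfolding q(1) Fract_of_int_quotient
    by (simp add: power_divide field_simps)
  then have ab: "a\<^sup>2 = d * b\<^sup>2" by (simp only: of_int_eq_iff)
  then have "b\<^sup>2 dvd a\<^sup>2" by simp
  then have "b = 1" using q(2,3)
    by (metis coprime_common_divisor dvd_refl pow_divides_pow_iff pos2 zdvd1_eq abs_of_pos)
  with ab have "d = a\<^sup>2" by simp
  with squarefreeD[OF d(1), of a] have "a dvd 1" by simp
  with \<open>d = a\<^sup>2\<close> d(2) show False by (auto simp: abs_if power2_eq_square split: if_splits)
qed

text \<open>The denominator is cleared by \<open>n / m = (n m) / m\<^sup>2\<close>, leaving an integer to decompose.\<close>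

lemma rat_eq_squarefree_times_square:
  assumes "c \<noteq> 0"
  obtains d s where "squarefree d" "s \<noteq> 0" "c = rat_of_int d * s\<^sup>2"
proof -
  obtain n m where c: "c = Fract n m" "m > 0" by (cases c) auto
  with assms have "n * m \<noteq> 0" by (auto simp: Zero_rat_def eq_rat)
  define d where "d = squarefree_part (n * m)"
  define k where "k = square_part (n * m)"
  have nm: "n * m = d * k\<^sup>2" unfolding d_def k_def by (rule squarefree_decompose)
  have "c = rat_of_int (n * m) / (of_int m)\<^sup>2"
    using c(2) by (simp add: c(1) Fract_of_int_quotient power2_eq_square)
  also have "\<dots> = rat_of_int d * (of_int k / of_int m)\<^sup>2"
    by (simp add: nm power_divide)
  finally have "c = rat_of_int d * (of_int k / of_int m)\<^sup>2" .
  moreover have "squarefree d" by (simp add: d_def)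
  moreover have "rat_of_int k / of_int m \<noteq> 0"
    using \<open>n * m \<noteq> 0\<close> by (simp add: k_def)
  ultimately show thesis using that by blast
qed

text \<open>Extending \<open>1\<close> to a basis \<open>1, w\<close> and completing the square: if \<open>w\<^sup>2 = c + b w\<close>, then
  \<open>(w - b/2)\<^sup>2 = c + b\<^sup>2/4\<close>.\<close>

lemma quadratic_algebra_generator:
  fixes L :: "'a::real_algebra_1 set"
  assumes L: "rat_subalgebra L" "rat_dim L = 2"
  obtains u c where "L = rat_span {1, u}" "u * u = c *\<^sub>Q 1" "\<And>q. u \<noteq> q *\<^sub>Q 1"
proof -
  have sub: "rat_subspace L" and one: "1 \<in> L" and mult: "\<And>x y. x \<in> L \<Longrightarrow> y \<in> L \<Longrightarrow> x * y \<in> L"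
    using L(1) by (auto simp: rat_subalgebra_def)
  have "\<not> rat_dependent {1::'a}" by (simp add: rat.dependent_single)
  then obtain B where B: "{1} \<subseteq> B" "B \<subseteq> L" "\<not> rat_dependent B" "L \<subseteq> rat_span B"
    using rat.maximal_independent_subset_extend[of "{1}" L] one by auto
  have "card B = 2"
    using rat.basis_card_eq_dim[OF B(2,4,3)] L(2) by simp
  with B(1) obtain w where w: "B = {1, w}" "w \<noteq> 1"
    by (auto simp: card_2_iff)
  have Lw: "L = rat_span {1, w}"
    using B(2,4) rat.span_minimal[OF B(2) sub] w by auto
  have w_irr: "w \<noteq> q *\<^sub>Q 1" for q
  proof
    assume "w = q *\<^sub>Q 1"
    then have "w \<in> rat_span {1}" by (auto simp: rat.span_singleton)
    moreover have "\<not> rat_dependent (insert w {1})" using B(3) w by (simp add: insert_commute)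
    ultimately show False using w(2) by (simp add: rat.independent_insert)
  qed
  have "w \<in> L" using B(2) w by auto
  with mult have "w * w \<in> range (quad_elt w)" by (simp add: Lw range_quad_elt)
  then obtain c b where ww: "w * w = c *\<^sub>Q 1 + b *\<^sub>Q w" by (auto simp: quad_elt_def)
  define u where "u = w - (b/2) *\<^sub>Q 1"
  have "u * u = w * w - (b/2) *\<^sub>Q w - (b/2) *\<^sub>Q w + (b/2 * (b/2)) *\<^sub>Q 1"
    by (simp add: u_def left_diff_distrib right_diff_distrib rat.scale_right_diff_distrib)
  also have "\<dots> = (c + b/2 * (b/2)) *\<^sub>Q 1 + (b - b/2 - b/2) *\<^sub>Q w"
    by (simp only: ww rat.scale_left_distrib rat.scale_left_diff_distrib) (simp add: algebra_simps)
  finally have "u * u = (c + b/2 * (b/2)) *\<^sub>Q 1" by simp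
  moreover have "u \<noteq> q *\<^sub>Q 1" for q
    using w_irr[of "q + b/2"] by (auto simp: u_def rat.scale_left_distrib algebra_simps)
  moreover have "L = rat_span {1, u}"
  proof
    have uL: "u \<in> L"
      unfolding u_def by (intro rat.subspace_diff rat.subspace_scale sub \<open>w \<in> L\<close> one)
    then show "rat_span {1, u} \<subseteq> L"
      by (intro rat.span_minimal sub) (use one in auto)
    have "w = quad_elt u (b/2, 1)" by (simp add: u_def quad_elt_def)
    then have "w \<in> rat_span {1, u}" using range_quad_elt by blast
    then show "L \<subseteq> rat_span {1, u}"
      unfolding Lw by (intro rat.span_minimal) (auto simp: rat.span_base)
  qed
  ultimately show thesis using that by blast
qed

text \<open>Reducedness excludes the dual numbers, the only two-dimensional algebra whose generator
  cannot be rescaled in this way.\<close>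

lemma quadratic_algebra_squarefree_generator:
  fixes L :: "'a::real_algebra_1 set"
  assumes L: "rat_subalgebra L" "rat_dim L = 2"
    and reduced: "\<And>x. x \<in> L \<Longrightarrow> x * x = 0 \<Longrightarrow> x = 0"
  obtains u d where "L = rat_span {1, u}" "squarefree d" "u * u = rat_of_int d *\<^sub>Q 1"
    "\<And>q. u \<noteq> q *\<^sub>Q 1"
proof -
  obtain v c where v: "L = rat_span {1, v}" "v * v = c *\<^sub>Q 1" "\<And>q. v \<noteq> q *\<^sub>Q 1"
    using quadratic_algebra_generator[OF L] by blast
  have "v \<in> L" by (simp add: v(1) rat.span_base)
  have "c \<noteq> 0"
    using reduced[OF \<open>v \<in> L\<close>] v(2) v(3)[of 0] by auto
  then obtain d s where ds: "squarefree d" "s \<noteq> 0" "c = rat_of_int d * s\<^sup>2"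
    by (rule rat_eq_squarefree_times_square)
  define u where "u = (1/s) *\<^sub>Q v"
  have vu: "v = s *\<^sub>Q u" using ds(2) by (simp add: u_def)
  have "u * u = (1/s * (1/s) * c) *\<^sub>Q 1"
    by (simp add: u_def rat_scale_mult v(2))
  also have "1/s * (1/s) * c = rat_of_int d"
    using ds(2) by (simp add: ds(3) power2_eq_square)
  finally have "u * u = rat_of_int d *\<^sub>Q 1" .
  moreover have "u \<noteq> q *\<^sub>Q 1" for q
    using v(3)[of "s * q"] by (auto simp: vu)
  moreover have "L = rat_span {1, u}"
  proof -
    have "u \<in> rat_span {1, v}"
      unfolding u_def by (intro rat.span_scale rat.span_base) simp
    moreover have "v \<in> rat_span {1, u}"
      unfolding vu by (intro rat.span_scale rat.span_base) simp
    ultimately show ?thesis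
      unfolding v(1) by (intro subset_antisym rat.span_minimal) (auto simp: rat.span_base)
  qed
  ultimately show thesis using that ds(1) by blast
qed

section \<open>Quadratic fields\<close>

lemma of_rat_in_subfield:
  assumes K: "is_subfield (K :: complex set)"
  shows "of_rat q \<in> K"
proof -
  have nat: "of_nat n \<in> K" for n
    using K by (induction n) (auto simp: is_subfield_def)
  have int: "of_int n \<in> K" for n
    using K nat by (cases n rule: int_cases2) (auto simp: is_subfield_def)
  obtain a b where "q = Fract a b" "b > 0" by (cases q) auto
  then have "of_rat q = of_int a * inverse (of_int b :: complex)"
    by (simp add: of_rat_rat divide_inverse)
  then show ?thesis using K int by (auto simp: is_subfield_def)
qed

lemma csqrt_squarefree_irrational:
  assumes "squarefree d" "d \<noteq> 1"
  shows "csqrt (of_int d) \<noteq> q *\<^sub>Q 1"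
proof
  assume "csqrt (of_int d) = q *\<^sub>Q 1"
  then have "(csqrt (of_int d))\<^sup>2 = of_rat (q\<^sup>2)"
    by (simp add: rat_scale_complex of_rat_power)
  then have "(of_rat (of_int d) :: complex) = of_rat (q\<^sup>2)"
    by simp
  then have "q\<^sup>2 = rat_of_int d" by (simp only: of_rat_eq_iff)
  with assms show False using squarefree_not_rat_square by blast
qed

lemma csqrt_mult_self: "csqrt (of_int d) * csqrt (of_int d) = rat_of_int d *\<^sub>Q 1"
  by (simp add: rat_scale_complex flip: power2_eq_square)

text \<open>Closure under inverses is rationalization of the denominator: the norm \<open>a\<^sup>2 - d b\<^sup>2\<close> of a
  nonzero \<open>a + b\<surd>d\<close> is the product with its conjugate, which is nonzero as well.\<close>

lemma quadratic_field_eq_span: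
  assumes d: "squarefree d" "d \<noteq> 1"
  shows "quadratic_field d = rat_span {1, csqrt (of_int d)}"
  unfolding quadratic_field_def
proof (rule hull_unique)
  define w where "w = csqrt (of_int d)"
  have ww: "w * w = rat_of_int d *\<^sub>Q 1" unfolding w_def by (rule csqrt_mult_self)
  have irr: "w \<noteq> q *\<^sub>Q 1" for q unfolding w_def by (rule csqrt_squarefree_irrational[OF d])
  show "{csqrt (of_int d)} \<subseteq> rat_span {1, csqrt (of_int d)}" by (simp add: rat.span_base)
  have alg: "rat_subalgebra (rat_span {1, w})" by (rule rat_subalgebra_span[OF ww])
  have inv: "inverse x \<in> rat_span {1, w}" if x: "x \<in> rat_span {1, w}" for x
  proof (cases "x = 0")
    case False
    from x obtain a b where xab: "x = quad_elt w (a, b)" by (auto simp flip: range_quad_elt)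
    define y where "y = quad_elt w (a, - b)"
    define N where "N = a * a - b * b * of_int d"
    have "x * y = of_rat N"
      unfolding xab y_def quad_elt_mult[OF ww] by (simp add: quad_elt_def N_def rat_scale_complex)
    moreover have "y \<noteq> 0"
      using False by (simp add: xab y_def quad_elt_eq_0_iff[OF irr])
    ultimately have "of_rat N \<noteq> (0::complex)" "inverse x = inverse (of_rat N) * y"
      using False by (auto simp: field_simps)
    then have "inverse x = of_rat (inverse N) * y" by (simp add: of_rat_inverse)
    then have "inverse x = inverse N *\<^sub>Q y" by (simp add: rat_scale_complex)
    moreover have "y \<in> rat_span {1, w}" by (simp add: y_def flip: range_quad_elt)
    ultimately show ?thesis by (simp add: rat.span_scale)
  qed (simp add: rat.span_zero)
  show "is_subfield (rat_span {1, csqrt (of_int d)})"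
    using alg inv unfolding w_def
    by (auto simp: is_subfield_def rat_subalgebra_def rat.span_zero rat.span_add rat.span_neg)
  show "rat_span {1, csqrt (of_int d)} \<subseteq> K" if "{csqrt (of_int d)} \<subseteq> K" "is_subfield K" for K
  proof (rule rat.span_minimal)
    show "rat_subspace K"
      using that(2) of_rat_in_subfield[OF that(2)]
      by (auto simp: rat.subspace_def rat_scale_complex is_subfield_def)
    show "{1, csqrt (of_int d)} \<subseteq> K"
      using that by (auto simp: is_subfield_def)
  qed
qed

section \<open>Subalgebras of the bicomplex numbers\<close>

lemmas bicomplex_ops = zero_bicomplex_def one_bicomplex_def plus_bicomplex_def uminus_bicomplex_def
  minus_bicomplex_def scaleR_bicomplex_def times_bicomplex_def

text \<open>The two projections onto \<open>\<complex>\<close> send \<open>x + y\<^bold>i + z\<^bold>j + t\<^bold>k\<close> to \<open>(x + z) + (y + t)\<^bold>i\<close> and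
  \<open>(x - z) + (y - t)\<^bold>i\<close>; each of these complex numbers squares to zero.\<close>

lemma bicomplex_square_eq_0:
  fixes u :: bicomplex
  assumes "u * u = 0"
  shows "u = 0"
proof -
  obtain x y z t where u: "u = Bicomplex x y z t" by (cases u)
  have zero: "Complex p q = 0" if "p * p - q * q = 0" "p * q = 0" for p q :: real
  proof -
    have "Complex p q * Complex p q = 0"
      using that by (simp add: complex_eq_iff mult.commute)
    then show ?thesis by simp
  qed
  have eqs: "x * x - y * y + z * z - t * t = 0" "x * y + z * t = 0"
      "x * z - y * t = 0" "x * t + y * z = 0"
    using assms by (simp_all add: u bicomplex_ops algebra_simps)
  have "Complex (x + z) (y + t) = 0" "Complex (x - z) (y - t) = 0"
    by (rule zero; use eqs in \<open>simp add: algebra_simps\<close>)+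
  then show ?thesis
    by (simp add: u bicomplex_ops complex_eq_iff)
qed

lemma bcj_irrational: "bcj \<noteq> q *\<^sub>Q 1"
  by (simp add: bcj_def rat_scale_def bicomplex_ops)

lemma bcj_mult_self: "bcj * bcj = 1 *\<^sub>Q 1"
  by (simp add: bc_mult_table)

lemma hyperbolic_extension_eq_span: "hyperbolic_extension = rat_span {1, bcj}"
  unfolding hyperbolic_extension_def by (rule rat_subalgebra_hull_eq_span[OF bcj_mult_self])

text \<open>The coordinates with respect to the two idempotents are the values of \<open>a + b\<^bold>j\<close> at
  \<open>\<^bold>j = 1\<close> and \<open>\<^bold>j = -1\<close>.\<close>

lemma hyperbolic_extension_idempotents:
  "hyperbolic_extension = {q *\<^sub>Q bce1 + r *\<^sub>Q bce2 | q r. True}"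
proof -
  have idem: "q *\<^sub>Q bce1 + r *\<^sub>Q bce2 = quad_elt bcj ((q + r) / 2, (q - r) / 2)" for q r
    by (simp add: quad_elt_def bce1_def bce2_def bcj_def rat_scale_def bicomplex_ops
        of_rat_add of_rat_diff of_rat_divide algebra_simps)
  have coords: "quad_elt bcj (a, b) = (a + b) *\<^sub>Q bce1 + (a - b) *\<^sub>Q bce2" for a b
    by (simp add: idem)
  have "range (quad_elt bcj) = {q *\<^sub>Q bce1 + r *\<^sub>Q bce2 | q r. True}"
  proof
    show "range (quad_elt bcj) \<subseteq> {q *\<^sub>Q bce1 + r *\<^sub>Q bce2 | q r. True}"
      using coords by fastforce
  qed (auto simp: idem)
  then show ?thesis by (simp add: hyperbolic_extension_eq_span range_quad_elt)
qed

lemma quadratic_bicomplex_extension_span: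
  assumes "u * u = c *\<^sub>Q 1" "\<And>q. u \<noteq> q *\<^sub>Q 1"
  shows "quadratic_bicomplex_extension (rat_span {1, u})"
  using rat_subalgebra_span[OF assms(1)] rat_dim_span_quadratic[OF assms(2)]
  by (simp add: quadratic_bicomplex_extension_def)

lemma quadratic_bicomplex_extension_cases:
  assumes "quadratic_bicomplex_extension L"
  shows "(\<exists>d::int. squarefree d \<and> d \<noteq> 1 \<and> rat_algebra_isomorphic L (quadratic_field d)) \<or>
    rat_algebra_isomorphic L hyperbolic_extension"
proof -
  have L: "rat_subalgebra L" "rat_dim L = 2"
    using assms by (simp_all add: quadratic_bicomplex_extension_def)
  obtain u d where u: "L = rat_span {1, u}" "squarefree d" "u * u = rat_of_int d *\<^sub>Q 1"
      "\<And>q. u \<noteq> q *\<^sub>Q 1"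
    using quadratic_algebra_squarefree_generator[OF L bicomplex_square_eq_0] by blast
  show ?thesis
  proof (cases "d = 1")
    case True
    have "bcj * bcj = rat_of_int d *\<^sub>Q 1" using bcj_mult_self True by simp
    then have "rat_algebra_isomorphic L hyperbolic_extension"
      unfolding u(1) hyperbolic_extension_eq_span
      by (rule rat_algebra_isomorphic_span_same_square[OF u(3,4) _ bcj_irrational])
    then show ?thesis ..
  next
    case False
    have "rat_algebra_isomorphic L (quadratic_field d)"
      unfolding u(1) quadratic_field_eq_span[OF u(2) False]
      by (rule rat_algebra_isomorphic_span_same_square[OF u(3,4) csqrt_mult_self
            csqrt_squarefree_irrational[OF u(2) False]])
    then show ?thesis using u(2) False by blast
  qed
qed

text \<open>The preimages in \<open>L\<close> of \<open>\<^bold>e\<^sub>1\<close> and \<open>\<^bold>e\<^sub>2\<close> are nonzero with product zero, and so are their images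
  in \<open>K\<close>, which lies in a field.\<close>

lemma not_isomorphic_field_and_hyperbolic:
  fixes L :: "'a::real_algebra_1 set" and K :: "'b::{real_algebra_1, field} set"
  assumes L: "rat_subalgebra L"
    and K: "rat_algebra_isomorphic L K"
    and H: "rat_algebra_isomorphic L hyperbolic_extension"
  shows False
proof -
  have L0: "0 \<in> L" and mult: "\<And>x y. x \<in> L \<Longrightarrow> y \<in> L \<Longrightarrow> x * y \<in> L"
    using L by (auto simp: rat_subalgebra_def rat.subspace_0)
  obtain f where f: "bij_betw f L K"
      "\<And>x y. x \<in> L \<Longrightarrow> y \<in> L \<Longrightarrow> f (x * y) = f x * f y"
      "\<And>q x. x \<in> L \<Longrightarrow> f (q *\<^sub>Q x) = q *\<^sub>Q f x"
    using K unfolding rat_algebra_isomorphic_def by blast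
  obtain g where g: "bij_betw g L hyperbolic_extension"
      "\<And>x y. x \<in> L \<Longrightarrow> y \<in> L \<Longrightarrow> g (x * y) = g x * g y"
      "\<And>q x. x \<in> L \<Longrightarrow> g (q *\<^sub>Q x) = q *\<^sub>Q g x"
    using H unfolding rat_algebra_isomorphic_def by blast
  have f0: "f 0 = 0" and g0: "g 0 = 0"
    using f(3)[OF L0, of 0] g(3)[OF L0, of 0] by simp_all
  have "bce1 = 1 *\<^sub>Q bce1 + 0 *\<^sub>Q bce2" "bce2 = 0 *\<^sub>Q bce1 + 1 *\<^sub>Q bce2" by simp_all
  then have "bce1 \<in> hyperbolic_extension" "bce2 \<in> hyperbolic_extension"
    unfolding hyperbolic_extension_idempotents by blast+
  then obtain x y where x: "x \<in> L" "g x = bce1" and y: "y \<in> L" "g y = bce2"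
    using bij_betw_imp_surj_on[OF g(1)] by (metis imageE)
  have ne: "bce1 \<noteq> 0" "bce2 \<noteq> 0" and ee: "bce1 * bce2 = 0"
    by (simp_all add: bce1_def bce2_def bcj_def bicomplex_ops)
  have "g (x * y) = g 0" using g(2) x y ee g0 by simp
  then have "x * y = 0"
    using bij_betw_imp_inj_on[OF g(1)] mult[OF x(1) y(1)] L0 by (auto dest: inj_onD)
  then have "f x * f y = 0" using f(2)[OF x(1) y(1)] f0 by simp
  then have "f x = f 0 \<or> f y = f 0" using f0 by simp
  then have "x = 0 \<or> y = 0"
    using bij_betw_imp_inj_on[OF f(1)] x(1) y(1) L0 by (auto dest: inj_onD)
  with x y ne g0 show False by auto
qed

text \<open>The first two coordinates embed \<open>\<complex>\<close>, hence also \<open>\<surd>d\<close>, in the bicomplex numbers.\<close>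

lemma quadratic_field_bicomplex_model:
  assumes d: "squarefree d" "d \<noteq> 1"
  shows "\<exists>L. quadratic_bicomplex_extension L \<and> rat_algebra_isomorphic L (quadratic_field d)"
proof -
  define w where "w = csqrt (of_int d)"
  define u where "u = Bicomplex (Re w) (Im w) 0 0"
  have "w * w = of_int d" by (simp add: w_def flip: power2_eq_square)
  then have uu: "u * u = rat_of_int d *\<^sub>Q 1"
    by (simp add: u_def bicomplex_ops rat_scale_def complex_eq_iff)
  have irr: "u \<noteq> q *\<^sub>Q 1" for q
  proof
    assume "u = q *\<^sub>Q 1"
    then have "w = q *\<^sub>Q 1"
      by (simp add: u_def bicomplex_ops rat_scale_def complex_eq_iff)
    then show False using csqrt_squarefree_irrational[OF d] by (simp add: w_def)
  qed
  have "rat_algebra_isomorphic (rat_span {1, u}) (quadratic_field d)"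
    unfolding quadratic_field_eq_span[OF d]
    by (rule rat_algebra_isomorphic_span_same_square[OF uu irr csqrt_mult_self
          csqrt_squarefree_irrational[OF d]])
  with quadratic_bicomplex_extension_span[OF uu irr] show ?thesis by blast
qed

theorem mainTheorem4:
  shows "(\<forall>L. quadratic_bicomplex_extension L \<longrightarrow>
            ((\<exists>d::int. squarefree d \<and> d \<noteq> 1 \<and> rat_algebra_isomorphic L (quadratic_field d)) \<or>
             rat_algebra_isomorphic L hyperbolic_extension) \<and>
            \<not> ((\<exists>d::int. squarefree d \<and> d \<noteq> 1 \<and> rat_algebra_isomorphic L (quadratic_field d)) \<and>
               rat_algebra_isomorphic L hyperbolic_extension)) \<and>
         (\<forall>d::int. squarefree d \<and> d \<noteq> 1 \<longrightarrow>
            (\<exists>L. quadratic_bicomplex_extension L \<and>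
                 rat_algebra_isomorphic L (quadratic_field d))) \<and>
         quadratic_bicomplex_extension hyperbolic_extension \<and>
         hyperbolic_extension = {q *\<^sub>Q bce1 + r *\<^sub>Q bce2 | q r. True}"
proof (intro conjI allI impI)
  fix L
  assume L: "quadratic_bicomplex_extension L"
  show "(\<exists>d::int. squarefree d \<and> d \<noteq> 1 \<and> rat_algebra_isomorphic L (quadratic_field d)) \<or>
      rat_algebra_isomorphic L hyperbolic_extension"
    by (rule quadratic_bicomplex_extension_cases[OF L])
  show "\<not> ((\<exists>d::int. squarefree d \<and> d \<noteq> 1 \<and> rat_algebra_isomorphic L (quadratic_field d)) \<and>
      rat_algebra_isomorphic L hyperbolic_extension)"
    using L not_isomorphic_field_and_hyperbolic[of L]
    by (auto simp: quadratic_bicomplex_extension_def)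
next
  fix d :: int
  assume "squarefree d \<and> d \<noteq> 1"
  then show "\<exists>L. quadratic_bicomplex_extension L \<and> rat_algebra_isomorphic L (quadratic_field d)"
    using quadratic_field_bicomplex_model by blast
next
  show "quadratic_bicomplex_extension hyperbolic_extension"
    unfolding hyperbolic_extension_eq_span
    by (rule quadratic_bicomplex_extension_span[OF bcj_mult_self bcj_irrational])
qed (rule hyperbolic_extension_idempotents)

end
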